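(* For every function $f\in\mathrm{FP}$ there exists a finite, orthogonal, and predicative recursive (constructor) TRS $\mathcal{R}_f$ that computes $f$.
   Context: $\mathrm{FP}$ is the class of polynomial-time computable functions (here on natural numbers in binary notation, represented as values built from a constant $\epsilon$ and unary constructors $\mathsf{S}_1,\mathsf{S}_2$). A TRS computes $f$ if for some defined symbol $g$ the relation $[\![g]\!]$ it defines is $f$, where $(v_1,\dots,v_n,w)\in[\![g]\!]$ iff $g(v_1,\dots,v_n)$ innermost-rewrites to the normal form value $w$. Terms: over a finite signature $\mathcal{F}=\mathcal{D}\uplus\mathcal{C}$ (defined symbols, constructors); values are terms of variables and constructors; basic terms are $h(v_1,\dots,v_n)$ with $h\in\mathcal{D}$, $v_i$ values; a constructor TRS has only basic left-hand sides. Orthogonal: left-linear and non-overlapping. Predicative recursive: a constructor TRS $\mathcal{R}$ with $l>_{\mathsf{pop*}}r$ for all rules, for some safe mapping and admissible precedence, where: a safe mapping assigns to each symbol a set of safe argument positions (all positions safe for constructors), writing $h(s_1,\dots,s_k;s_{k+1},\dots,s_{k+l})$ with the first $k$ normal; a precedence is a preorder $\succsim$ ($\succ$ strict, $\sim$ equivalence), admissible if $\sim$ only relates two defined symbols or two constructors; $s\approx t$ iff $s=t$ or $s=h(\vec s)$, $t=g(\vec t)$, $h\sim g$, with a permutation $\pi$, $s_i\approx t_{\pi(i)}$, preserving normal/safe status; $\mathcal{T}(\mathcal{F}_{<h},\mathcal{V})$ are terms over variables and symbols below $h$. For $s=h(s_1,\dots,s_{k+l})$: $s>_{\mathsf{sq}}t$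 iff $s_i(>_{\mathsf{sq}}\cup\approx)t$ for some $i$ (normal if $h\in\mathcal{D}$), or $h\in\mathcal{D}$, $t=g(t_1..t_p)$, $h\succ g$, $s>_{\mathsf{sq}}t_i$ for all $i$. $s>_{\mathsf{pop*}}t$ iff (1) $s_i\ge_{\mathsf{pop*}}t$ for some $i$; or (2) $h\in\mathcal{D}$, $t=g(t_1..t_m;t_{m+1}..t_{m+n})$, $h\succ g$, $s>_{\mathsf{sq}}t_j$ for normal $j$, $s>_{\mathsf{pop*}}t_j$ for safe $j$, at most one safe $t_j\notin\mathcal{T}(\mathcal{F}_{<h},\mathcal{V})$; or (3) $h\in\mathcal{D}$, $h\sim g$, normal arguments decrease in the strict multiset extension of $>_{\mathsf{pop*}}$ and safe arguments in the weak one (modulo $\approx$); $\ge_{\mathsf{pop*}}={>_{\mathsf{pop*}}}\cup\approx$. *)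

theory Defs
  imports Main "HOL-Library.Multiset" "HOL-Computational_Algebra.Polynomial"
begin

section \<open>Polynomial-time computable functions on natural numbers\<close>

text \<open>
  Binary notation with the digits 1 and 2 (bijective base 2), least significant digit first:
  the empty word denotes 0, and prefixing the digit \<open>i\<close> maps the denotation \<open>n\<close> to \<open>2 * n + i\<close>.
\<close>

fun digits :: "nat \<Rightarrow> nat list" where
  "digits 0 = []"
| "digits (Suc n) = (if even n then 1 # digits (n div 2) else 2 # digits (n div 2))"

lemma digits_double_plus_1: "digits (2 * n + 1) = 1 # digits n"
  by simp

lemma digits_double_plus_2: "digits (2 * n + 2) = 2 # digits n"
  by simp

text \<open>
  Deterministic Turing machines with one two-way infinite tape. States and tape symbols are initial
  segments of the natural numbers; the initial state is 0, and \<open>delta\<close> is undefined (\<open>None\<close>) where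
  the machine halts. The tape symbol 0 is the blank, 1 and 2 are the digits, and 3 terminates each
  argument of the input.
\<close>

datatype direction = Move_Left | Move_Right | Stay

record turing_machine =
  n_states :: nat
  n_symbols :: nat
  delta :: "nat \<Rightarrow> nat \<Rightarrow> (nat \<times> nat \<times> direction) option"

definition wf_tm :: "turing_machine \<Rightarrow> bool" where
  "wf_tm M \<longleftrightarrow> 1 \<le> n_states M \<and> 4 \<le> n_symbols M \<and>
     (\<forall>q a q' b d. q < n_states M \<longrightarrow> a < n_symbols M \<longrightarrow> delta M q a = Some (q', b, d) \<longrightarrow>
        q' < n_states M \<and> b < n_symbols M)"

text \<open>
  In a configuration \<open>(q, ls, rs)\<close> the list \<open>rs\<close> is the tape content from the head to the right and
  \<open>ls\<close> the content to the left of the head, the nearest cell first. All cells beyond the two lists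
  are blank.
\<close>

type_synonym config = "nat \<times> nat list \<times> nat list"

fun cell :: "nat list \<Rightarrow> nat" where
  "cell [] = 0"
| "cell (a # as) = a"

fun move :: "direction \<Rightarrow> nat list \<times> nat list \<Rightarrow> nat list \<times> nat list" where
  "move Stay (ls, rs) = (ls, rs)"
| "move Move_Left (ls, rs) = (tl ls, cell ls # rs)"
| "move Move_Right (ls, rs) = (cell rs # ls, tl rs)"

fun tm_step :: "turing_machine \<Rightarrow> config \<Rightarrow> config option" where
  "tm_step M (q, ls, rs) =
     (case delta M q (cell rs) of
        None \<Rightarrow> None
      | Some (q', b, d) \<Rightarrow> Some (q', move d (ls, b # tl rs)))"

text \<open>Halted configurations are repeated.\<close>

definition tm_run :: "turing_machine \<Rightarrow> nat \<Rightarrow> config \<Rightarrow> config" where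
  "tm_run M n = (\<lambda>c. case tm_step M c of None \<Rightarrow> c | Some c' \<Rightarrow> c') ^^ n"

definition input_word :: "nat list \<Rightarrow> nat list" where
  "input_word xs = concat (map (\<lambda>x. digits x @ [3]) xs)"

fun output_word :: "config \<Rightarrow> nat list" where
  "output_word (q, ls, rs) = takeWhile (\<lambda>a. a \<in> {1, 2}) rs"

text \<open>The \<open>k\<close>-ary functions in \<open>FP\<close>; only the values of \<open>f\<close> on lists of length \<open>k\<close> are relevant.\<close>

definition FP :: "nat \<Rightarrow> (nat list \<Rightarrow> nat) set" where
  "FP k = {f. \<exists>M (p :: nat poly). wf_tm M \<and>
     (\<forall>xs. length xs = k \<longrightarrow>
        (\<exists>n \<le> poly p (length (input_word xs)).
           let c = tm_run M n (0, [], input_word xs)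
           in tm_step M c = None \<and> output_word c = digits (f xs)))}"


section \<open>Terms and signatures\<close>

datatype ('f, 'v) trm = Var 'v | Fun 'f "('f, 'v) trm list"

record 'f signature =
  defined :: "'f set"
  constrs :: "'f set"
  arity :: "'f \<Rightarrow> nat"

definition symbols :: "'f signature \<Rightarrow> 'f set" where
  "symbols F = defined F \<union> constrs F"

definition finite_signature :: "'f signature \<Rightarrow> bool" where
  "finite_signature F \<longleftrightarrow>
     finite (defined F) \<and> finite (constrs F) \<and> defined F \<inter> constrs F = {}"

inductive wf_trm :: "'f signature \<Rightarrow> ('f, 'v) trm \<Rightarrow> bool" for F where
  "wf_trm F (Var x)"
| "h \<in> symbols F \<Longrightarrow> length ts = arity F h \<Longrightarrow> (\<forall>t\<in>set ts. wf_trm F t) \<Longrightarrow> wf_trm F (Fun h ts)"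

text \<open>Values may contain variables.\<close>

inductive is_value :: "'f signature \<Rightarrow> ('f, 'v) trm \<Rightarrow> bool" for F where
  "is_value F (Var x)"
| "c \<in> constrs F \<Longrightarrow> length ts = arity F c \<Longrightarrow> (\<forall>t\<in>set ts. is_value F t) \<Longrightarrow>
     is_value F (Fun c ts)"

definition is_basic :: "'f signature \<Rightarrow> ('f, 'v) trm \<Rightarrow> bool" where
  "is_basic F t \<longleftrightarrow> (\<exists>h ts. t = Fun h ts \<and> h \<in> defined F \<and> length ts = arity F h \<and>
     (\<forall>u\<in>set ts. is_value F u))"

primrec vars_list :: "('f, 'v) trm \<Rightarrow> 'v list" where
  "vars_list (Var x) = [x]"
| "vars_list (Fun h ts) = concat (map vars_list ts)"

primrec funs :: "('f, 'v) trm \<Rightarrow> 'f set" where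
  "funs (Var x) = {}"
| "funs (Fun h ts) = insert h (\<Union> (set (map funs ts)))"

primrec subterms :: "('f, 'v) trm \<Rightarrow> ('f, 'v) trm set" where
  "subterms (Var x) = {Var x}"
| "subterms (Fun h ts) = insert (Fun h ts) (\<Union> (set (map subterms ts)))"

primrec subst :: "('v \<Rightarrow> ('f, 'w) trm) \<Rightarrow> ('f, 'v) trm \<Rightarrow> ('f, 'w) trm" where
  "subst \<sigma> (Var x) = \<sigma> x"
| "subst \<sigma> (Fun h ts) = Fun h (map (subst \<sigma>) ts)"


section \<open>Term rewriting\<close>

type_synonym ('f, 'v) rule = "('f, 'v) trm \<times> ('f, 'v) trm"
type_synonym ('f, 'v) trs = "('f, 'v) rule set"

definition wf_trs :: "'f signature \<Rightarrow> ('f, 'v) trs \<Rightarrow> bool" where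
  "wf_trs F R \<longleftrightarrow> (\<forall>(l, r)\<in>R. wf_trm F l \<and> wf_trm F r \<and>
     (\<nexists>x. l = Var x) \<and> set (vars_list r) \<subseteq> set (vars_list l))"

definition constructor_trs :: "'f signature \<Rightarrow> ('f, 'v) trs \<Rightarrow> bool" where
  "constructor_trs F R \<longleftrightarrow> wf_trs F R \<and> (\<forall>(l, r)\<in>R. is_basic F l)"

definition left_linear :: "('f, 'v) trs \<Rightarrow> bool" where
  "left_linear R \<longleftrightarrow> (\<forall>(l, r)\<in>R. distinct (vars_list l))"

definition variants :: "('f, 'v) rule \<Rightarrow> ('f, 'v) rule \<Rightarrow> bool" where
  "variants \<rho>\<^sub>1 \<rho>\<^sub>2 \<longleftrightarrow> (\<exists>\<pi>. bij \<pi> \<and>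
     fst \<rho>\<^sub>2 = subst (\<lambda>x. Var (\<pi> x)) (fst \<rho>\<^sub>1) \<and> snd \<rho>\<^sub>2 = subst (\<lambda>x. Var (\<pi> x)) (snd \<rho>\<^sub>1))"

text \<open>
  Using two independent substitutions amounts to unifying after renaming the two rules apart.
  A subterm \<open>u\<close> of \<open>l\<^sub>1\<close> occurs at the root iff \<open>u = l\<^sub>1\<close>; overlaps of a rule with (a variant of)
  itself at the root are disregarded.
\<close>

definition non_overlapping :: "('f, 'v) trs \<Rightarrow> bool" where
  "non_overlapping R \<longleftrightarrow>
     (\<forall>(l\<^sub>1, r\<^sub>1)\<in>R. \<forall>(l\<^sub>2, r\<^sub>2)\<in>R. \<forall>u\<in>subterms l\<^sub>1.
        (\<nexists>x. u = Var x) \<longrightarrow> (u \<noteq> l\<^sub>1 \<or> \<not> variants (l\<^sub>1, r\<^sub>1) (l\<^sub>2, r\<^sub>2)) \<longrightarrow>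
        \<not> (\<exists>\<sigma> \<tau> :: 'v \<Rightarrow> ('f, 'v) trm. subst \<sigma> u = subst \<tau> l\<^sub>2))"

definition orthogonal :: "('f, 'v) trs \<Rightarrow> bool" where
  "orthogonal R \<longleftrightarrow> left_linear R \<and> non_overlapping R"

inductive rewrite :: "('f, 'v) trs \<Rightarrow> ('f, 'v) trm \<Rightarrow> ('f, 'v) trm \<Rightarrow> bool" for R where
  "(l, r) \<in> R \<Longrightarrow> rewrite R (subst \<sigma> l) (subst \<sigma> r)"
| "rewrite R s t \<Longrightarrow> rewrite R (Fun h (us @ s # vs)) (Fun h (us @ t # vs))"

definition normal_form :: "('f, 'v) trs \<Rightarrow> ('f, 'v) trm \<Rightarrow> bool" where
  "normal_form R t \<longleftrightarrow> (\<nexists>u. rewrite R t u)"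

inductive irewrite :: "('f, 'v) trs \<Rightarrow> ('f, 'v) trm \<Rightarrow> ('f, 'v) trm \<Rightarrow> bool" for R where
  "(l, r) \<in> R \<Longrightarrow> (\<forall>u \<in> subterms (subst \<sigma> l) - {subst \<sigma> l}. normal_form R u) \<Longrightarrow>
     irewrite R (subst \<sigma> l) (subst \<sigma> r)"
| "irewrite R s t \<Longrightarrow> irewrite R (Fun h (us @ s # vs)) (Fun h (us @ t # vs))"

text \<open>The relation on values defined by the symbol \<open>g\<close>.\<close>

definition defined_relation ::
  "'f signature \<Rightarrow> ('f, 'v) trs \<Rightarrow> 'f \<Rightarrow> (('f, 'v) trm list \<times> ('f, 'v) trm) set" where
  "defined_relation F R g =
     {(vs, w). length vs = arity F g \<and> (\<forall>v\<in>set vs. is_value F v) \<and> is_value F w \<and>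
        (irewrite R)\<^sup>*\<^sup>* (Fun g vs) w \<and> normal_form R w}"


section \<open>Computing number-theoretic functions\<close>

text \<open>An unlimited supply of symbols besides those used to denote natural numbers.\<close>

datatype symb = Eps | S1 | S2 | Sym nat

definition numeral_trm :: "nat \<Rightarrow> (symb, 'v) trm" where
  "numeral_trm n = foldr (\<lambda>d t. Fun (if d = 1 then S1 else S2) [t]) (digits n) (Fun Eps [])"

definition computes ::
  "symb signature \<Rightarrow> (symb, 'v) trs \<Rightarrow> nat \<Rightarrow> (nat list \<Rightarrow> nat) \<Rightarrow> bool" where
  "computes F R k f \<longleftrightarrow>
     {Eps, S1, S2} \<subseteq> constrs F \<and> arity F Eps = 0 \<and> arity F S1 = 1 \<and> arity F S2 = 1 \<and>
     (\<exists>g\<in>defined F. arity F g = k \<and>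
        defined_relation F R g =
          {(map numeral_trm xs, numeral_trm (f xs)) |xs. length xs = k})"


section \<open>Predicative recursive rewrite systems\<close>

text \<open>
  Argument positions are counted from 0. Normal and safe arguments are not required to be separated
  in the argument list: the normal (safe) arguments of \<open>h\<close> are those at positions outside (inside)
  \<open>safe h\<close>.
\<close>

definition safe_mapping :: "'f signature \<Rightarrow> ('f \<Rightarrow> nat set) \<Rightarrow> bool" where
  "safe_mapping F safe \<longleftrightarrow> (\<forall>h\<in>symbols F. safe h \<subseteq> {..<arity F h}) \<and>
     (\<forall>c\<in>constrs F. safe c = {..<arity F c})"

definition normal_args :: "('f \<Rightarrow> nat set) \<Rightarrow> 'f \<Rightarrow> 'a list \<Rightarrow> 'a multiset" where
  "normal_args safe h ts = mset (nths ts (- safe h))"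

definition safe_args :: "('f \<Rightarrow> nat set) \<Rightarrow> 'f \<Rightarrow> 'a list \<Rightarrow> 'a multiset" where
  "safe_args safe h ts = mset (nths ts (safe h))"

text \<open>A pair \<open>(g, h)\<close> in the precedence means that \<open>g\<close> is at least as large as \<open>h\<close>.\<close>

definition prec_gt :: "('f \<times> 'f) set \<Rightarrow> 'f \<Rightarrow> 'f \<Rightarrow> bool" where
  "prec_gt prec g h \<longleftrightarrow> (g, h) \<in> prec \<and> (h, g) \<notin> prec"

definition prec_eq :: "('f \<times> 'f) set \<Rightarrow> 'f \<Rightarrow> 'f \<Rightarrow> bool" where
  "prec_eq prec g h \<longleftrightarrow> (g, h) \<in> prec \<and> (h, g) \<in> prec"

definition admissible_precedence :: "'f signature \<Rightarrow> ('f \<times> 'f) set \<Rightarrow> bool" where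
  "admissible_precedence F prec \<longleftrightarrow> preorder_on (symbols F) prec \<and>
     (\<forall>g h. prec_eq prec g h \<longrightarrow>
        g \<in> defined F \<and> h \<in> defined F \<or> g \<in> constrs F \<and> h \<in> constrs F)"

inductive equiv_trm ::
  "('f \<Rightarrow> nat set) \<Rightarrow> ('f \<times> 'f) set \<Rightarrow> ('f, 'v) trm \<Rightarrow> ('f, 'v) trm \<Rightarrow> bool"
  for safe prec where
  "equiv_trm safe prec t t"
| "prec_eq prec h g \<Longrightarrow> length ss = length ts \<Longrightarrow>
   bij_betw \<pi> {..<length ss} {..<length ts} \<Longrightarrow>
   (\<forall>i<length ss. equiv_trm safe prec (ss ! i) (ts ! \<pi> i) \<and> (i \<in> safe h \<longleftrightarrow> \<pi> i \<in> safe g)) \<Longrightarrow>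
   equiv_trm safe prec (Fun h ss) (Fun g ts)"

text \<open>The terms over variables and symbols strictly below \<open>h\<close>.\<close>

definition trms_below :: "('f \<times> 'f) set \<Rightarrow> 'f \<Rightarrow> ('f, 'v) trm set" where
  "trms_below prec h = {t. \<forall>g\<in>funs t. prec_gt prec h g}"

text \<open>Strict and weak multiset extension of \<open>gt\<close> modulo the equivalence \<open>eq\<close>.\<close>

definition mul_gt ::
  "('a \<Rightarrow> 'a \<Rightarrow> bool) \<Rightarrow> ('a \<Rightarrow> 'a \<Rightarrow> bool) \<Rightarrow> 'a multiset \<Rightarrow> 'a multiset \<Rightarrow> bool" where
  "mul_gt gt eq M N \<longleftrightarrow> (\<exists>X Y X' Y'. M = X + Y \<and> N = X' + Y' \<and> rel_mset eq X X' \<and>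
     Y \<noteq> {#} \<and> (\<forall>b\<in>#Y'. \<exists>a\<in>#Y. gt a b))"

definition mul_ge ::
  "('a \<Rightarrow> 'a \<Rightarrow> bool) \<Rightarrow> ('a \<Rightarrow> 'a \<Rightarrow> bool) \<Rightarrow> 'a multiset \<Rightarrow> 'a multiset \<Rightarrow> bool" where
  "mul_ge gt eq M N \<longleftrightarrow> mul_gt gt eq M N \<or> rel_mset eq M N"

lemma mul_gt_mono [mono]:
  "(\<And>x y. A x y \<longrightarrow> B x y) \<Longrightarrow> mul_gt A eq M N \<longrightarrow> mul_gt B eq M N"
  unfolding mul_gt_def by (intro impI, elim exE, intro exI) blast

lemma mul_ge_mono [mono]:
  "(\<And>x y. A x y \<longrightarrow> B x y) \<Longrightarrow> mul_ge A eq M N \<longrightarrow> mul_ge B eq M N"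
  unfolding mul_ge_def using mul_gt_mono[of A B] by blast

inductive gt_sq ::
  "'f signature \<Rightarrow> ('f \<Rightarrow> nat set) \<Rightarrow> ('f \<times> 'f) set \<Rightarrow> ('f, 'v) trm \<Rightarrow> ('f, 'v) trm \<Rightarrow> bool"
  for F safe prec where
  sq_subterm:
    "i < length ss \<Longrightarrow> (h \<in> defined F \<longrightarrow> i \<notin> safe h) \<Longrightarrow>
     gt_sq F safe prec (ss ! i) t \<or> equiv_trm safe prec (ss ! i) t \<Longrightarrow>
     gt_sq F safe prec (Fun h ss) t"
| sq_precedence:
    "h \<in> defined F \<Longrightarrow> prec_gt prec h g \<Longrightarrow>
     (\<forall>t\<in>set ts. gt_sq F safe prec (Fun h ss) t) \<Longrightarrow>
     gt_sq F safe prec (Fun h ss) (Fun g ts)"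

inductive gt_pop ::
  "'f signature \<Rightarrow> ('f \<Rightarrow> nat set) \<Rightarrow> ('f \<times> 'f) set \<Rightarrow> ('f, 'v) trm \<Rightarrow> ('f, 'v) trm \<Rightarrow> bool"
  for F safe prec where
  pop_subterm:
    "i < length ss \<Longrightarrow>
     gt_pop F safe prec (ss ! i) t \<or> equiv_trm safe prec (ss ! i) t \<Longrightarrow>
     gt_pop F safe prec (Fun h ss) t"
| pop_precedence:
    "h \<in> defined F \<Longrightarrow> prec_gt prec h g \<Longrightarrow>
     (\<forall>j<length ts. j \<notin> safe g \<longrightarrow> gt_sq F safe prec (Fun h ss) (ts ! j)) \<Longrightarrow>
     (\<forall>j<length ts. j \<in> safe g \<longrightarrow> gt_pop F safe prec (Fun h ss) (ts ! j)) \<Longrightarrow>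
     card {j. j < length ts \<and> j \<in> safe g \<and> ts ! j \<notin> trms_below prec h} \<le> 1 \<Longrightarrow>
     gt_pop F safe prec (Fun h ss) (Fun g ts)"
| pop_equivalence:
    "h \<in> defined F \<Longrightarrow> prec_eq prec h g \<Longrightarrow>
     mul_gt (gt_pop F safe prec) (equiv_trm safe prec)
       (normal_args safe h ss) (normal_args safe g ts) \<Longrightarrow>
     mul_ge (gt_pop F safe prec) (equiv_trm safe prec)
       (safe_args safe h ss) (safe_args safe g ts) \<Longrightarrow>
     gt_pop F safe prec (Fun h ss) (Fun g ts)"

definition predicative_recursive :: "'f signature \<Rightarrow> ('f, 'v) trs \<Rightarrow> bool" where
  "predicative_recursive F R \<longleftrightarrow> constructor_trs F R \<and>
     (\<exists>safe prec. safe_mapping F safe \<and> admissible_precedence F prec \<and>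
        (\<forall>(l, r)\<in>R. gt_pop F safe prec l r))"

end

theory Submission
  imports Defs "HOL-Library.Confluence"
begin

text \<open>
  The system runs the Turing machine directly. Configurations are values, and one machine step is a
  symbol \<open>Step\<close> whose only argument is safe, so its rules merely rearrange constructors. Since
  \<open>Run(a(x); c) \<rightarrow> Step(; Run(x; c))\<close> recurses on a normal argument, \<open>Run\<close> iterates \<open>Step\<close> as often
  as its clock is long. The clock is a word whose length is the time bound \<open>p\<close> at the length of the
  input, obtained by a Horner scheme in which concatenation adds and \<open>Mult\<close> multiplies lengths. The
  main symbol composes all this in normal argument positions, which the order allows for symbols
  below it.

  The results on numerals are unique by the diamond property of innermost rewriting in orthogonal
  systems.
\<close>

section \<open>Innermost rewriting in orthogonal systems\<close>

declare is_value.intros(1) [simp] wf_trm.intros(1) [simp]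

lemma is_value_Fun [simp]:
  "is_value F (Fun c ts) \<longleftrightarrow>
     c \<in> constrs F \<and> length ts = arity F c \<and> (\<forall>t\<in>set ts. is_value F t)"
  by (auto intro: is_value.intros elim: is_value.cases)

lemma wf_trm_Fun [simp]:
  "wf_trm F (Fun h ts) \<longleftrightarrow>
     h \<in> symbols F \<and> length ts = arity F h \<and> (\<forall>t\<in>set ts. wf_trm F t)"
  by (auto intro: wf_trm.intros elim: wf_trm.cases)

lemma subst_cong:
  assumes "\<And>x. x \<in> set (vars_list t) \<Longrightarrow> \<sigma> x = \<tau> x"
  shows "subst \<sigma> t = subst \<tau> t"
  using assms by (induction t) auto

lemma subst_eq_imp_vars_eq:
  assumes "subst \<sigma> t = subst \<tau> t" "x \<in> set (vars_list t)"
  shows "\<sigma> x = \<tau> x"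
  using assms by (induction t) auto

lemma subst_rename: "subst \<tau> (subst (\<lambda>x. Var (\<pi> x)) t) = subst (\<tau> \<circ> \<pi>) t"
  by (induction t) auto

lemma subst_Var_id: "subst Var t = t"
  by (induction t) (auto simp: map_idI)

lemma variants_refl: "variants \<rho> \<rho>"
  unfolding variants_def by (rule exI[of _ id]) (simp add: subst_Var_id)

lemma subterms_refl [simp]: "t \<in> subterms t"
  by (cases t) auto

lemma irewrite_imp_rewrite: "irewrite R s t \<Longrightarrow> rewrite R s t"
  by (induction rule: irewrite.induct) (auto intro: rewrite.intros)

text \<open>Non-overlap at the root leaves only variants: the second rule is the first one renamed
  by \<open>\<pi>\<close>. So \<open>\<sigma>\<close> and \<open>\<tau> \<circ> \<pi>\<close> agree
  on the variables of \<open>l\<^sub>1\<close>, among which are all variables of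
  \<open>r\<^sub>1\<close>.\<close>

lemma subst_root_overlap:
  fixes \<sigma> \<tau> :: "'v \<Rightarrow> ('f, 'v) trm"
  assumes R: "wf_trs F R" "non_overlapping R"
    and rules: "(l\<^sub>1, r\<^sub>1) \<in> R" "(l\<^sub>2, r\<^sub>2) \<in> R" and eq: "subst \<sigma> l\<^sub>1 = subst \<tau> l\<^sub>2"
  shows "subst \<sigma> r\<^sub>1 = subst \<tau> r\<^sub>2"
proof -
  have "\<nexists>x. l\<^sub>1 = Var x" and vars: "set (vars_list r\<^sub>1) \<subseteq> set (vars_list l\<^sub>1)"
    using R(1) rules(1) by (auto simp: wf_trs_def)
  \<comment> \<open>Non-overlap is instantiated with the subterm \<open>u = l\<^sub>1\<close>, so
    that \<open>eq\<close> can only be excused by the two rules being variants.\<close>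
  with R(2)[unfolded non_overlapping_def, THEN bspec, OF rules(1), unfolded prod.case,
      THEN bspec, OF rules(2), unfolded prod.case, THEN bspec, OF subterms_refl] eq
  have "variants (l\<^sub>1, r\<^sub>1) (l\<^sub>2, r\<^sub>2)"
    by blast
  then obtain \<pi> where \<pi>: "l\<^sub>2 = subst (\<lambda>x. Var (\<pi> x)) l\<^sub>1" "r\<^sub>2 = subst (\<lambda>x. Var (\<pi> x)) r\<^sub>1"
    by (auto simp: variants_def)
  then have "subst \<sigma> l\<^sub>1 = subst (\<tau> \<circ> \<pi>) l\<^sub>1"
    using eq by (simp add: subst_rename)
  then have "subst \<sigma> r\<^sub>1 = subst (\<tau> \<circ> \<pi>) r\<^sub>1"
    using vars by (intro subst_cong) (blast dest: subst_eq_imp_vars_eq)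
  then show ?thesis
    using \<pi> by (simp add: subst_rename)
qed

lemma proper_arg: "a \<in> subterms (Fun h (us @ a # vs)) - {Fun h (us @ a # vs)}"
proof -
  have "size a < size (Fun h (us @ a # vs))" by simp
  then show ?thesis by (metis DiffI UN_I in_set_conv_decomp insertI2 less_irrefl list.set_map
    singletonD subterms.simps(2) subterms_refl)
qed

text \<open>An innermost root step needs normal arguments, so it never competes with a step below
  the root. Two root steps have the same result, steps in different arguments commute, and steps in
  the same argument fall under the induction hypothesis. Hence one step on each side suffices to
  join.\<close>

lemma irewrite_diamond:
  assumes R: "wf_trs F R" "non_overlapping R"
  shows "irewrite R s t \<Longrightarrow> irewrite R s u \<Longrightarrow> t = u \<or> (\<exists>w. irewrite R t w \<and> irewrite R u w)"
proof (induction arbitrary: u rule: irewrite.induct)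
  case (1 l r \<sigma>)
  from \<open>irewrite R (subst \<sigma> l) u\<close> show ?case
  proof (cases rule: irewrite.cases)
    case (1 l' r' \<tau>)
    then show ?thesis
      using subst_root_overlap[OF R] \<open>(l, r) \<in> R\<close> by metis
  next
    case (2 a b h us vs)
    then have "normal_form R a"
      using 1(2) proper_arg by metis
    then show ?thesis
      using 2(3) irewrite_imp_rewrite by (auto simp: normal_form_def)
  qed
next
  case (2 a b h us vs)
  from \<open>irewrite R (Fun h (us @ a # vs)) u\<close> show ?case
  proof (cases rule: irewrite.cases)
    case (1 l' r' \<tau>)
    then have "normal_form R a"
      using proper_arg[of a h us vs] by metis
    then show ?thesis
      using 2(1) irewrite_imp_rewrite by (auto simp: normal_form_def)
  next
    case (2 a' b' us' vs')
    then have eq: "us @ a # vs = us' @ a' # vs'" by auto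
    have u: "u = Fun h (us' @ b' # vs')" using 2 by simp
    \<comment> \<open>The second redex position coincides with the first, lies to its left, or lies
      to its right.\<close>
    consider (same) "us' = us" "a' = a" "vs' = vs"
      | (left) ws where "us = us' @ a' # ws" "vs' = ws @ a # vs"
      | (right) ws where "us' = us @ a # ws" "vs = ws @ a' # vs'"
      using eq by (auto simp: append_eq_append_conv2 Cons_eq_append_conv append_eq_Cons_conv)
    then show ?thesis
    proof cases
      case same
      then show ?thesis
        using "2.IH"[of b'] 2(3) u by (auto intro: irewrite.intros)
    next
      case left
      have "irewrite R (Fun h (us @ b # vs)) (Fun h (us' @ b' # ws @ b # vs))"
        using irewrite.intros(2)[OF 2(3), of h us' "ws @ b # vs"] left by simp
      moreover have "irewrite R u (Fun h ((us' @ b' # ws) @ b # vs))"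
        using irewrite.intros(2)[OF \<open>irewrite R a b\<close>, of h "us' @ b' # ws" vs] left u by simp
      ultimately show ?thesis by auto
    next
      case right
      have "irewrite R (Fun h (us @ b # vs)) (Fun h ((us @ b # ws) @ b' # vs'))"
        using irewrite.intros(2)[OF 2(3), of h "us @ b # ws" vs'] right by simp
      moreover have "irewrite R u (Fun h (us @ b # ws @ b' # vs'))"
        using irewrite.intros(2)[OF \<open>irewrite R a b\<close>, of h us "ws @ b' # vs'"] right u by simp
      ultimately show ?thesis by auto
    qed
  qed
qed

lemma irewrite_normal_form_unique:
  assumes R: "wf_trs F R" "non_overlapping R"
    and "(irewrite R)\<^sup>*\<^sup>* s t" "(irewrite R)\<^sup>*\<^sup>* s u" "normal_form R t" "normal_form R u"
  shows "t = u"
proof -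
  have "strong_confluentp (irewrite R)"
    using irewrite_diamond[OF R] by (intro strong_confluentpI) blast
  then obtain w where "(irewrite R)\<^sup>*\<^sup>* t w" "(irewrite R)\<^sup>*\<^sup>* u w"
    using assms(3,4) strong_confluentp_imp_confluentp confluentpD by metis
  \<comment> \<open>A reduction that starts in a normal form is empty, so both \<open>t\<close> and
    \<open>u\<close> equal the common reduct.\<close>
  moreover have "w = v" if "(irewrite R)\<^sup>*\<^sup>* v w" "normal_form R v" for v
    using that by (induction rule: converse_rtranclp_induct)
      (auto simp: normal_form_def dest: irewrite_imp_rewrite)
  ultimately show ?thesis using assms(5,6) by blast
qed

lemma irewrite_arg:
  assumes "(irewrite R)\<^sup>*\<^sup>* s t"
  shows "(irewrite R)\<^sup>*\<^sup>* (Fun h (us @ s # vs)) (Fun h (us @ t # vs))"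
  using assms by (induction) (auto intro: irewrite.intros rtranclp.rtrancl_into_rtrancl)

lemma irewrite_args:
  assumes "list_all2 (irewrite R)\<^sup>*\<^sup>* ss ts"
  shows "(irewrite R)\<^sup>*\<^sup>* (Fun h ss) (Fun h ts)"
proof -
  \<comment> \<open>The prefix \<open>us\<close> collects the arguments that are already reduced,
    which lets the induction proceed from left to right.\<close>
  have "(irewrite R)\<^sup>*\<^sup>* (Fun h (us @ ss)) (Fun h (us @ ts))" for us
    using assms
  proof (induction arbitrary: us rule: list_all2_induct)
    case (Cons s ss t ts)
    show ?case
      using irewrite_arg[OF Cons(1)] Cons.IH[of "us @ [t]"] by (auto intro: rtranclp_trans)
  qed simp
  from this[of "[]"] show ?thesis by simp
qed

section \<open>Values as normal forms, and calls on values as innermost redexes\<close>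

lemma value_subterms: "is_value F t \<Longrightarrow> u \<in> subterms t \<Longrightarrow> is_value F u"
  by (induction rule: is_value.induct) auto

lemma basic_proper_subterms:
  assumes "is_basic F t" "u \<in> subterms t" "u \<noteq> t"
  shows "is_value F u"
proof -
  obtain h ts where "t = Fun h ts" "\<forall>s\<in>set ts. is_value F s"
    using assms(1) by (auto simp: is_basic_def)
  then show ?thesis using assms(2,3) value_subterms by auto
qed

text \<open>Every redex has a defined root, and \<open>finite_signature\<close> makes defined
  symbols and constructors disjoint.\<close>

lemma value_normal_form:
  assumes F: "finite_signature F" and R: "constructor_trs F R" and v: "is_value F v"
  shows "normal_form R v"
proof -
  have "\<not> is_value F s" if "rewrite R s t" for s t
    using that
  proof (induction rule: rewrite.induct)
    case (1 l r \<sigma>)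
    then obtain h ts where "l = Fun h ts" "h \<in> defined F"
      using R by (auto simp: constructor_trs_def is_basic_def)
    then show ?case
      using F by (auto simp: finite_signature_def)
  qed auto
  with v show ?thesis by (auto simp: normal_form_def)
qed

lemma irewrite_root_values:
  assumes F: "finite_signature F" and R: "constructor_trs F R" and rule: "(Fun h ls, r) \<in> R"
    and args: "\<And>t. t \<in> set ls \<Longrightarrow> is_value F (subst \<sigma> t)"
  shows "irewrite R (Fun h (map (subst \<sigma>) ls)) (subst \<sigma> r)"
proof -
  have "normal_form R u" if "u \<in> subterms (subst \<sigma> (Fun h ls)) - {subst \<sigma> (Fun h ls)}" for u
    using that args value_subterms value_normal_form[OF F R] by fastforce
  then show ?thesis
    using irewrite.intros(1)[OF rule, of \<sigma>] by simp
qed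


section \<open>The path order\<close>

lemma equiv_refl [simp]: "equiv_trm safe prec t t"
  by (rule equiv_trm.intros)

lemma gt_sq_arg: "t \<in> set ss \<Longrightarrow> safe h = {} \<Longrightarrow> gt_sq F safe prec (Fun h ss) t"
  by (auto simp: in_set_conv_nth intro: gt_sq.intros(1))

lemma gt_pop_arg: "t \<in> set ss \<Longrightarrow> gt_pop F safe prec (Fun h ss) t"
  by (auto simp: in_set_conv_nth intro: pop_subterm)

lemma gt_pop_arg': "s \<in> set ss \<Longrightarrow> gt_pop F safe prec s t \<Longrightarrow> gt_pop F safe prec (Fun h ss) t"
  by (auto simp: in_set_conv_nth intro: pop_subterm)

lemma gt_pop_var:
  assumes "x \<in> set (vars_list (Fun h ss))"
  shows "gt_pop F safe prec (Fun h ss) (Var x)"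
proof -
  have "x \<in> set (vars_list s) \<Longrightarrow> s = Var x \<or> gt_pop F safe prec s (Var x)" for s
    by (induction s) (auto intro: gt_pop_arg gt_pop_arg')
  from this[OF assms] show ?thesis by simp
qed

text \<open>\<open>sq_precedence\<close> peels off the smaller symbols until a variable is reached,
  which is a direct argument of \<open>h\<close> and normal because \<open>h\<close> has no safe
  positions. Together with \<open>gt_pop_below\<close> this orients the rule of the main symbol,
  whatever composition its right-hand side is.\<close>

lemma gt_sq_below:
  assumes "h \<in> defined F" "safe h = {}" "t \<in> trms_below prec h" "Var ` set (vars_list t) \<subseteq> set ss"
  shows "gt_sq F safe prec (Fun h ss) t"
  using assms(3,4)
proof (induction t)
  case (Var x)
  then show ?case using gt_sq_arg assms(2) by force
next
  case (Fun g ts)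
  then have "\<forall>t\<in>set ts. gt_sq F safe prec (Fun h ss) t"
    by (force simp: trms_below_def)
  then show ?case
    using Fun.prems assms(1) by (auto simp: trms_below_def intro: sq_precedence)
qed

lemma card_below_0:
  assumes "\<forall>t\<in>set ts. t \<in> trms_below prec h"
  shows "card {j. j < length ts \<and> j \<in> A \<and> ts ! j \<notin> trms_below prec h} \<le> 1"
proof -
  have "{j. j < length ts \<and> j \<in> A \<and> ts ! j \<notin> trms_below prec h} = {}"
    using assms nth_mem by fastforce
  then show ?thesis by (simp only: card.empty)
qed

lemma gt_pop_below:
  assumes "h \<in> defined F" "safe h = {}" "t \<in> trms_below prec h" "Var ` set (vars_list t) \<subseteq> set ss"
  shows "gt_pop F safe prec (Fun h ss) t"
  using assms(3,4)
proof (induction t)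
  case (Var x)
  then show ?case using gt_pop_arg by force
next
  case (Fun g ts)
  have below: "\<forall>t\<in>set ts. t \<in> trms_below prec h \<and> Var ` set (vars_list t) \<subseteq> set ss"
    using Fun.prems by (force simp: trms_below_def)
  show ?case
  proof (rule pop_precedence)
    show "prec_gt prec h g" using Fun.prems by (simp add: trms_below_def)
    show "\<forall>j<length ts. j \<notin> safe g \<longrightarrow> gt_sq F safe prec (Fun h ss) (ts ! j)"
      using below gt_sq_below assms nth_mem by meson
    show "\<forall>j<length ts. j \<in> safe g \<longrightarrow> gt_pop F safe prec (Fun h ss) (ts ! j)"
      using below Fun.IH nth_mem by meson
  qed (use assms(1) below card_below_0[of ts prec h] in auto)
qed

text \<open>All positions of a constructor are safe, so \<open>pop_precedence\<close> never asks for
  \<open>gt_sq\<close> here. The variables are then reached by \<open>pop_subterm\<close>, which may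
  enter safe arguments and descend to any depth. This is what allows the only argument of
  \<open>Step\<close> to be safe.\<close>

lemma gt_pop_below_constrs:
  assumes "h \<in> defined F" "safe_mapping F safe"
    and "t \<in> trms_below prec h" "is_value F t"
    and "set (vars_list t) \<subseteq> set (vars_list (Fun h ss))"
  shows "gt_pop F safe prec (Fun h ss) t"
  using assms(3-5)
proof (induction t)
  case (Fun g ts)
  have below: "t \<in> trms_below prec h" if "t \<in> set ts" for t
    using Fun.prems that by (auto simp: trms_below_def)
  have args: "gt_pop F safe prec (Fun h ss) t" if t: "t \<in> set ts" for t
  proof (rule Fun.IH[OF t below[OF t]])
    show "is_value F t" using Fun.prems t by simp
    show "set (vars_list t) \<subseteq> set (vars_list (Fun h ss))"
      using Fun.prems t by (auto simp del: vars_list.simps(2)) (auto simp: subset_iff)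
  qed
  have safe: "safe g = {..<length ts}"
    using Fun.prems assms(2) by (simp add: safe_mapping_def)
  show ?case
  proof (rule pop_precedence)
    show "prec_gt prec h g" using Fun.prems by (simp add: trms_below_def)
    show "\<forall>j<length ts. j \<in> safe g \<longrightarrow> gt_pop F safe prec (Fun h ss) (ts ! j)"
      using args nth_mem by blast
    show "card {j. j < length ts \<and> j \<in> safe g \<and> ts ! j \<notin> trms_below prec h} \<le> 1"
      by (rule card_below_0) (use below in blast)
  qed (use assms(1) safe in auto)
qed (simp add: gt_pop_var del: vars_list.simps(2))

section \<open>Multiset comparison for recursive calls\<close>

lemma rel_mset_refl [simp]: "(\<And>x. r x x) \<Longrightarrow> rel_mset r A A"
  by (induction A) (auto intro: rel_mset_Plus)

lemma mul_ge_refl: "(\<And>x. eq x x) \<Longrightarrow> mul_ge gt eq A A"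
  by (simp add: mul_ge_def)

lemma mul_gt_add_mset:
  assumes "\<And>x. eq x x" "gt a b"
  shows "mul_gt gt eq (add_mset a A) (add_mset b A)"
  unfolding mul_gt_def
  by (rule exI[of _ A], rule exI[of _ "{#a#}"], rule exI[of _ A], rule exI[of _ "{#b#}"])
    (use assms in auto)

text \<open>Covers recursion on the first argument: the normal arguments differ only in
  \<open>s\<close> against \<open>t\<close>, and the safe arguments are the same multiset.\<close>

lemma gt_pop_rec:
  assumes "h \<in> defined F" "(h, h) \<in> prec" "gt_pop F safe prec s t" "0 \<notin> safe h"
  shows "gt_pop F safe prec (Fun h (s # us)) (Fun h (t # us))"
proof (rule pop_equivalence)
  show "mul_gt (gt_pop F safe prec) (equiv_trm safe prec)
      (normal_args safe h (s # us)) (normal_args safe h (t # us))"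
    using assms(3,4) by (simp add: normal_args_def nths_Cons mul_gt_add_mset)
  show "mul_ge (gt_pop F safe prec) (equiv_trm safe prec)
      (safe_args safe h (s # us)) (safe_args safe h (t # us))"
    using assms(4) by (simp add: safe_args_def nths_Cons mul_ge_refl)
qed (use assms in \<open>auto simp: prec_eq_def\<close>)


section \<open>The rewrite system of a Turing machine\<close>

datatype fname = Step | App | Mult | Run | Out | Chk | Main

instance fname :: finite
proof
  have "(UNIV :: fname set) = {Step, App, Mult, Run, Out, Chk, Main}"
    by (auto intro: fname.exhaust)
  then show "finite (UNIV :: fname set)" by (metis finite.emptyI finite.insertI)
qed

text \<open>The rank induces the precedence: apart from recursive calls, a rule for a symbol
  mentions only defined symbols of smaller rank.\<close>

primrec frank :: "fname \<Rightarrow> nat" where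
  "frank Step = 1"
| "frank App = 2"
| "frank Mult = 3"
| "frank Run = 4"
| "frank Out = 5"
| "frank Chk = 6"
| "frank Main = 7"

text \<open>Indices modulo 3 keep the defined symbols, the tape letters and the machine states
  apart.\<close>

definition fn :: "fname \<Rightarrow> symb" where
  "fn f = Sym (3 * frank f)"

text \<open>The digits 1 and 2 share their constructors with the numerals, so that a numeral already
  is a tape word and needs no translation on input or output.\<close>

definition tape :: "nat \<Rightarrow> symb" where
  "tape a = (if a = 1 then S1 else if a = 2 then S2 else Sym (3 * a + 1))"

definition state :: "nat \<Rightarrow> symb" where
  "state q = Sym (3 * q + 2)"

lemma inj_frank: "frank f = frank g \<longleftrightarrow> f = g"
  by (cases f; cases g) auto

lemma symb_simps [simp]:
  "fn f = fn g \<longleftrightarrow> f = g" "tape a = tape b \<longleftrightarrow> a = b" "state q = state q' \<longleftrightarrow> q = q'"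
  "fn f \<noteq> tape a" "tape a \<noteq> fn f" "fn f \<noteq> state q" "state q \<noteq> fn f"
  "tape a \<noteq> state q" "state q \<noteq> tape a"
  "fn f \<noteq> Eps" "Eps \<noteq> fn f" "tape a \<noteq> Eps" "Eps \<noteq> tape a" "state q \<noteq> Eps" "Eps \<noteq> state q"
  unfolding fn_def tape_def state_def by (auto simp: inj_frank split: if_splits; presburger)+

section \<open>Words, patterns and configurations as terms\<close>

abbreviation "nil \<equiv> Fun Eps []"

primrec word :: "nat list \<Rightarrow> (symb, nat) trm \<Rightarrow> (symb, nat) trm" where
  "word [] t = t"
| "word (a # as) t = Fun (tape a) [word as t]"

lemma word_append: "word (as @ bs) t = word as (word bs t)"
  by (induction as) auto

lemma subst_word [simp]: "subst \<sigma> (word as t) = word as (subst \<sigma> t)"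
  by (induction as) auto

lemma vars_word [simp]: "vars_list (word as t) = vars_list t"
  by (induction as) auto

lemma funs_word [simp]: "funs (word as t) = tape ` set as \<union> funs t"
  by (induction as) auto

lemma set_digits: "set (digits n) \<subseteq> {1, 2}"
  by (induction n rule: digits.induct) auto

lemma numeral_trm_word: "numeral_trm n = word (digits n) nil"
proof -
  have "set ds \<subseteq> {1, 2} \<Longrightarrow>
    foldr (\<lambda>d t. Fun (if d = 1 then S1 else S2) [t]) ds nil = word ds nil" for ds
    by (induction ds) (auto simp: tape_def)
  then show ?thesis using set_digits by (simp add: numeral_trm_def)
qed

text \<open>
  The patterns \<open>pat o x\<close> with \<open>o = None\<close> and \<open>o = Some a\<close> match the empty word and the words
  beginning with \<open>a\<close>; \<open>rest\<close> and \<open>scanned\<close> are the tail and the first cell of a word matched.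
\<close>

primrec pat :: "nat option \<Rightarrow> nat \<Rightarrow> (symb, nat) trm" where
  "pat None x = nil"
| "pat (Some a) x = Fun (tape a) [Var x]"

primrec rest :: "nat option \<Rightarrow> nat \<Rightarrow> (symb, nat) trm" where
  "rest None x = nil"
| "rest (Some a) x = Var x"

primrec scanned :: "nat option \<Rightarrow> nat" where
  "scanned None = 0"
| "scanned (Some a) = a"

fun first :: "nat list \<Rightarrow> nat option" where
  "first [] = None"
| "first (a # as) = Some a"

lemma scanned_first [simp]: "scanned (first as) = cell as"
  by (cases as) auto

lemma subst_pat_first [simp]: "\<sigma> x = word (tl as) nil \<Longrightarrow> subst \<sigma> (pat (first as) x) = word as nil"
  by (cases as) auto

lemma subst_rest_first [simp]:
  "\<sigma> x = word (tl as) nil \<Longrightarrow> subst \<sigma> (rest (first as) x) = word (tl as) nil"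
  by (cases as) auto

lemma subst_pat_inj: "subst \<sigma> (pat i x) = subst \<tau> (pat j y) \<Longrightarrow> i = j"
  by (cases i; cases j) auto

lemma subst_pat_neq [simp]:
  "subst \<sigma> (pat i x) \<noteq> Fun (state q) ts" "Fun (state q) ts \<noteq> subst \<sigma> (pat i x)"
  by (cases i; auto)+

lemma distinct_vars_pat [simp]:
  "distinct (vars_list (pat i x))" "x \<noteq> y \<Longrightarrow> y \<notin> set (vars_list (pat i x))"
  by (cases i; auto)+

fun cfg :: "config \<Rightarrow> (symb, nat) trm" where
  "cfg (q, ls, rs) = Fun (state q) [word ls nil, word rs nil]"

section \<open>The rules for a given machine and time bound\<close>

locale tm_trs =
  fixes M :: turing_machine and k :: nat and p :: "nat poly"
  assumes wf: "wf_tm M"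
begin

abbreviation Q where "Q \<equiv> {..<n_states M}"
abbreviation A where "A \<equiv> {..<n_symbols M}"

definition opts :: "nat option set" where
  "opts = insert None (Some ` A)"

text \<open>Evaluates to the \<open>input_word\<close> of the arguments: each numeral is put in
  front of the terminator 3 and the remaining input.\<close>

definition input_term :: "nat list \<Rightarrow> (symb, nat) trm" where
  "input_term is = foldr (\<lambda>i t. Fun (fn App) [Var i, Fun (tape 3) [t]]) is nil"

text \<open>Horner scheme in unary: prefixing \<open>c\<close> letters adds the coefficient, and
  \<open>Mult\<close> multiplies by the input length. Only the length of the value counts; the
  letter 1 is an arbitrary choice.\<close>

definition clock :: "nat list \<Rightarrow> (symb, nat) trm" where
  "clock cs = foldr (\<lambda>c t. word (replicate c 1) (Fun (fn Mult) [input_term [0..<k], t])) cs nil"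

definition body :: "(symb, nat) trm" where
  "body = Fun (fn Out) [Fun (fn Run) [clock (coeffs p),
     Fun (state 0) [nil, input_term [0..<k]]]]"

text \<open>
  The guard \<open>Chk\<close> at the root keeps calls on values that are not numerals from producing a value:
  a term that is stuck below the root could still be erased.
\<close>

definition guarded :: "nat list \<Rightarrow> (symb, nat) trm" where
  "guarded is = foldr (\<lambda>i t. Fun (fn Chk) [Var i, t]) is body"

text \<open>The first argument is consumed digit by digit before the second is released. The rules
  for \<open>Chk\<close> cover the empty word and the letters 1 and 2 only, so any other value
  blocks it.\<close>

primrec chk_rhs :: "nat option \<Rightarrow> (symb, nat) trm" where
  "chk_rhs None = Var 1"
| "chk_rhs (Some a) = Fun (fn Chk) [Var 0, Var 1]"

primrec app_rhs :: "nat option \<Rightarrow> (symb, nat) trm" where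
  "app_rhs None = Var 1"
| "app_rhs (Some a) = Fun (tape a) [Fun (fn App) [Var 0, Var 1]]"

primrec mult_rhs :: "nat option \<Rightarrow> (symb, nat) trm" where
  "mult_rhs None = nil"
| "mult_rhs (Some a) = Fun (fn App) [Var 1, Fun (fn Mult) [Var 0, Var 1]]"

primrec run_rhs :: "nat option \<Rightarrow> (symb, nat) trm" where
  "run_rhs None = Var 1"
| "run_rhs (Some a) = Fun (fn Step) [Fun (fn Run) [Var 0, Var 1]]"

primrec out_rhs :: "nat option \<Rightarrow> (symb, nat) trm" where
  "out_rhs None = nil"
| "out_rhs (Some a) = (if a \<in> {1, 2} then Fun (tape a) [Fun (fn Out) [Var 0]] else nil)"

text \<open>The patterns \<open>i\<close> and \<open>j\<close> match the words left and right of the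
  head. An exhausted word is scanned as the blank 0, and a halted configuration is returned
  unchanged, so surplus clock ticks do no harm.\<close>

definition step_rhs :: "nat \<Rightarrow> nat option \<Rightarrow> nat option \<Rightarrow> (symb, nat) trm" where
  "step_rhs q i j =
    (case delta M q (scanned j) of
       None \<Rightarrow> Fun (state q) [pat i 0, pat j 1]
     | Some (q', b, d) \<Rightarrow>
         Fun (state q') (case d of
           Stay \<Rightarrow> [pat i 0, Fun (tape b) [rest j 1]]
         | Move_Left \<Rightarrow> [rest i 0, Fun (tape (scanned i)) [Fun (tape b) [rest j 1]]]
         | Move_Right \<Rightarrow> [Fun (tape b) [pat i 0], rest j 1]))"

definition rules :: "(symb, nat) trs" where
  "rules =
     {(Fun (fn Main) (map Var [0..<k]), guarded [0..<k])}
   \<union> (\<lambda>i. (Fun (fn Chk) [pat i 0, Var 1], chk_rhs i)) ` {None, Some 1, Some 2}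
   \<union> (\<lambda>i. (Fun (fn App) [pat i 0, Var 1], app_rhs i)) ` opts
   \<union> (\<lambda>i. (Fun (fn Mult) [pat i 0, Var 1], mult_rhs i)) ` opts
   \<union> (\<lambda>i. (Fun (fn Run) [pat i 0, Var 1], run_rhs i)) ` opts
   \<union> (\<lambda>i. (Fun (fn Out) [pat i 0], out_rhs i)) ` opts
   \<union> (\<lambda>q. (Fun (fn Out) [Fun (state q) [Var 0, Var 1]], Fun (fn Out) [Var 1])) ` Q
   \<union> (\<lambda>(q, i, j). (Fun (fn Step) [Fun (state q) [pat i 0, pat j 1]], step_rhs q i j)) `
       (Q \<times> opts \<times> opts)"

lemma rules_cases [consumes 1, case_names main chk app mult run out out_state step]:
  assumes "(l, r) \<in> rules"
  obtains "l = Fun (fn Main) (map Var [0..<k])" "r = guarded [0..<k]"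
  | i where "i \<in> {None, Some 1, Some 2}" "l = Fun (fn Chk) [pat i 0, Var 1]" "r = chk_rhs i"
  | i where "i \<in> opts" "l = Fun (fn App) [pat i 0, Var 1]" "r = app_rhs i"
  | i where "i \<in> opts" "l = Fun (fn Mult) [pat i 0, Var 1]" "r = mult_rhs i"
  | i where "i \<in> opts" "l = Fun (fn Run) [pat i 0, Var 1]" "r = run_rhs i"
  | i where "i \<in> opts" "l = Fun (fn Out) [pat i 0]" "r = out_rhs i"
  | q where "q \<in> Q" "l = Fun (fn Out) [Fun (state q) [Var 0, Var 1]]" "r = Fun (fn Out) [Var 1]"
  | q i j where "q \<in> Q" "i \<in> opts" "j \<in> opts"
      "l = Fun (fn Step) [Fun (state q) [pat i 0, pat j 1]]" "r = step_rhs q i j"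
  using assms unfolding rules_def by (elim UnE imageE SigmaE; clarsimp; blast)

lemma finite_rules: "finite rules"
  by (simp add: rules_def opts_def)

section \<open>Signature, safe mapping and precedence\<close>

primrec fn_arity :: "fname \<Rightarrow> nat" where
  "fn_arity Step = 1"
| "fn_arity App = 2"
| "fn_arity Mult = 2"
| "fn_arity Run = 2"
| "fn_arity Out = 1"
| "fn_arity Chk = 2"
| "fn_arity Main = k"

text \<open>Recursion arguments must be normal. The argument of \<open>Step\<close> and the second
  argument of \<open>App\<close> are safe because they receive recursive results, of
  \<open>Run\<close> and \<open>Mult\<close>. The second argument of \<open>Mult\<close> is normal
  because it is passed to the normal position of \<open>App\<close>.\<close>

primrec fn_safe :: "fname \<Rightarrow> nat set" where
  "fn_safe Step = {0}"
| "fn_safe App = {1}"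
| "fn_safe Mult = {}"
| "fn_safe Run = {1}"
| "fn_safe Out = {}"
| "fn_safe Chk = {1}"
| "fn_safe Main = {}"

text \<open>Membership in ranges stands in for pattern matching, since \<open>fn\<close>,
  \<open>tape\<close> and \<open>state\<close> are functions rather than datatype constructors. The
  last branch serves the tape letters.\<close>

definition symb_arity :: "symb \<Rightarrow> nat" where
  "symb_arity s = (if s = Eps then 0 else if s \<in> range state then 2
     else if s \<in> range fn then fn_arity (inv fn s) else 1)"

definition symb_safe :: "symb \<Rightarrow> nat set" where
  "symb_safe s = (if s \<in> range fn then fn_safe (inv fn s) else {..<symb_arity s})"

text \<open>Constructors get rank 0, below all defined symbols, whose ranks are positive.
  Equivalence in \<open>prec\<close> therefore never mixes the two kinds.\<close>

definition symb_rank :: "symb \<Rightarrow> nat" where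
  "symb_rank s = (if s \<in> range fn then frank (inv fn s) else 0)"

lemma inv_fn [simp]: "inv fn (fn f) = f"
  by (simp add: inv_f_f inj_def)

lemma symb_arity_simps [simp]:
  "symb_arity Eps = 0" "symb_arity (state q) = 2" "symb_arity (fn f) = fn_arity f"
  "symb_arity (tape a) = 1"
  by (auto simp: symb_arity_def)

lemma symb_safe_simps [simp]:
  "symb_safe (fn f) = fn_safe f" "symb_safe Eps = {}" "symb_safe (state q) = {..<2}"
  "symb_safe (tape a) = {..<1}"
  by (auto simp: symb_safe_def)

lemma symb_rank_simps [simp]:
  "symb_rank Eps = 0" "symb_rank (state q) = 0" "symb_rank (fn f) = frank f"
  "symb_rank (tape a) = 0"
  by (auto simp: symb_rank_def)

definition sig :: "symb signature" where
  "sig = \<lparr>defined = range fn, constrs = {Eps} \<union> tape ` A \<union> state ` Q, arity = symb_arity\<rparr>"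

lemma sig_simps [simp]:
  "defined sig = range fn" "constrs sig = {Eps} \<union> tape ` A \<union> state ` Q" "arity sig = symb_arity"
  "symbols sig = range fn \<union> {Eps} \<union> tape ` A \<union> state ` Q"
  by (auto simp: sig_def symbols_def)

definition prec :: "(symb \<times> symb) set" where
  "prec = {(g, h). g \<in> symbols sig \<and> h \<in> symbols sig \<and> symb_rank h \<le> symb_rank g}"

lemma prec_gt_fn [simp]: "prec_gt prec (fn f) g \<longleftrightarrow> g \<in> symbols sig \<and> symb_rank g < frank f"
  by (auto simp: prec_gt_def prec_def)

lemma prec_refl [simp]: "(fn f, fn f) \<in> prec"
  by (simp add: prec_def)

lemma finite_sig: "finite_signature sig"
  by (auto simp: finite_signature_def)

lemma safe_mapping_sig: "safe_mapping sig symb_safe"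
proof -
  have "x < fn_arity f" if "x \<in> fn_safe f" for x f
    using that by (cases f) auto
  then show ?thesis by (auto simp: safe_mapping_def)
qed

lemma frank_pos [simp]: "frank f \<noteq> 0" "0 < frank f"
  by (cases f; simp)+

lemma admissible: "admissible_precedence sig prec"
  by (auto simp: admissible_precedence_def preorder_on_def refl_on_def trans_def prec_eq_def prec_def)

lemma letters [simp]: "0 < n_symbols M" "Suc 0 < n_symbols M" "2 < n_symbols M" "3 < n_symbols M"
  "0 < n_states M"
  using wf by (auto simp: wf_tm_def)

lemma letter_cases [simp]: "None \<in> opts" "Some a \<in> opts \<longleftrightarrow> a \<in> A"
  by (auto simp: opts_def)

section \<open>Well-formedness of the rules\<close>

lemma pat_value [simp]: "i \<in> opts \<Longrightarrow> is_value sig (pat i x)"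
  by (cases i) auto

lemma rest_value [simp]: "i \<in> opts \<Longrightarrow> is_value sig (rest i x)"
  by (cases i) auto

lemma scanned_letter [simp]: "i \<in> opts \<Longrightarrow> scanned i < n_symbols M"
  using letters by (cases i) auto

lemma vars_rest: "set (vars_list (rest i x)) \<subseteq> set (vars_list (pat i x))"
  by (cases i) auto

lemma value_wf: "is_value sig t \<Longrightarrow> wf_trm sig t"
  by (induction rule: is_value.induct) auto

lemma value_below: "is_value sig t \<Longrightarrow> t \<in> trms_below prec (fn f)"
proof (induction rule: is_value.induct)
  case (2 c ts)
  then show ?case by (auto simp: trms_below_def)
qed (simp add: trms_below_def)

lemma delta_wf:
  "delta M q a = Some (q', b, d) \<Longrightarrow> q < n_states M \<Longrightarrow> a < n_symbols M \<Longrightarrow>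
     q' < n_states M \<and> b < n_symbols M"
  using wf unfolding wf_tm_def by blast

lemma step_rhs_value:
  assumes "q \<in> Q" "i \<in> opts" "j \<in> opts"
  shows "is_value sig (step_rhs q i j)"
    "set (vars_list (step_rhs q i j)) \<subseteq> set (vars_list (pat i 0)) \<union> set (vars_list (pat j 1))"
proof -
  have "is_value sig (step_rhs q i j) \<and>
    set (vars_list (step_rhs q i j)) \<subseteq> set (vars_list (pat i 0)) \<union> set (vars_list (pat j 1))"
  proof (cases "delta M q (scanned j)")
    case None
    then show ?thesis using assms by (simp add: step_rhs_def)
  next
    case (Some a)
    obtain q' b d where a: "a = (q', b, d)" by (cases a)
    have "q' < n_states M" "b < n_symbols M"
      using delta_wf[of q "scanned j" q' b d] Some a assms by auto
    then show ?thesis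
      using Some a assms vars_rest[of i 0] vars_rest[of j 1]
      by (cases d) (simp_all add: step_rhs_def le_supI1 le_supI2)
  qed
  then show "is_value sig (step_rhs q i j)"
    "set (vars_list (step_rhs q i j)) \<subseteq> set (vars_list (pat i 0)) \<union> set (vars_list (pat j 1))"
    by blast+
qed

text \<open>Stated for any list of argument indices, because the induction removes indices from
  \<open>[0..<k]\<close>.\<close>

lemma input_term_props:
  assumes "set is \<subseteq> {..<k}"
  shows "wf_trm sig (input_term is)" "set (vars_list (input_term is)) \<subseteq> {..<k}"
    "input_term is \<in> trms_below prec (fn Main)"
  using assms letters by (induction "is") (auto simp: input_term_def trms_below_def)

lemma word_wf: "set as \<subseteq> A \<Longrightarrow> wf_trm sig t \<Longrightarrow> wf_trm sig (word as t)"
  by (induction as) auto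

lemma clock_props:
  "wf_trm sig (clock cs)" "set (vars_list (clock cs)) \<subseteq> {..<k}"
  "clock cs \<in> trms_below prec (fn Main)"
proof -
  have "set [0..<k] \<subseteq> {..<k}" by auto
  note inp = input_term_props[OF this]
  have clock_Cons: "clock (c # cs) = word (replicate c 1) (Fun (fn Mult) [input_term [0..<k], clock cs])"
    for c cs by (simp add: clock_def)
  have "wf_trm sig (clock cs) \<and> set (vars_list (clock cs)) \<subseteq> {..<k} \<and>
    clock cs \<in> trms_below prec (fn Main)"
  proof (induction cs)
    case (Cons c cs)
    have "set (replicate c 1) \<subseteq> A" using letters by auto
    with Cons inp show ?case
      unfolding clock_Cons by (intro conjI word_wf) (auto simp: trms_below_def)
  qed (simp add: clock_def trms_below_def)
  then show "wf_trm sig (clock cs)" "set (vars_list (clock cs)) \<subseteq> {..<k}"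
    "clock cs \<in> trms_below prec (fn Main)" by blast+
qed

lemma guarded_props:
  assumes "set is \<subseteq> {..<k}"
  shows "wf_trm sig (guarded is)" "set (vars_list (guarded is)) \<subseteq> {..<k}"
    "guarded is \<in> trms_below prec (fn Main)"
proof -
  have "set [0..<k] \<subseteq> {..<k}" by auto
  note inp = input_term_props[OF this]
  have body: "wf_trm sig body" "set (vars_list body) \<subseteq> {..<k}" "body \<in> trms_below prec (fn Main)"
    using inp clock_props[of "coeffs p"] letters by (auto simp: body_def trms_below_def)
  have "wf_trm sig (guarded is) \<and> set (vars_list (guarded is)) \<subseteq> {..<k} \<and>
    guarded is \<in> trms_below prec (fn Main)"
    using assms
  proof (induction "is")
    case (Cons i "is")
    have "guarded (i # is) = Fun (fn Chk) [Var i, guarded is]" by (simp add: guarded_def)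
    with Cons show ?case by (auto simp: trms_below_def)
  qed (use body in \<open>simp add: guarded_def\<close>)
  then show "wf_trm sig (guarded is)" "set (vars_list (guarded is)) \<subseteq> {..<k}"
    "guarded is \<in> trms_below prec (fn Main)" by blast+
qed

lemma digit_opts: "i \<in> {None, Some 1, Some 2} \<Longrightarrow> i \<in> opts"
  using letters by auto

lemma pat_wf [simp]: "i \<in> opts \<Longrightarrow> wf_trm sig (pat i x)"
  by (simp add: value_wf)

lemma wf_rules: "wf_trs sig rules"
proof -
  have "wf_trm sig l \<and> wf_trm sig r \<and> (\<nexists>x. l = Var x) \<and> set (vars_list r) \<subseteq> set (vars_list l)"
    if "(l, r) \<in> rules" for l r
    using that
  proof (cases rule: rules_cases)
    case main
    then show ?thesis using guarded_props[of "[0..<k]"] by (auto simp: atLeast0LessThan)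
  next
    case (chk i)
    then show ?thesis using digit_opts[of i] by auto
  next
    case (app i)
    then show ?thesis by (cases i) auto
  next
    case (mult i)
    then show ?thesis by (cases i) auto
  next
    case (run i)
    then show ?thesis by (cases i) auto
  next
    case (out i)
    then show ?thesis by (cases i) auto
  next
    case (out_state q)
    then show ?thesis by auto
  next
    case (step q i j)
    then show ?thesis using step_rhs_value[of q i j] value_wf[of "step_rhs q i j"] by auto
  qed
  then show ?thesis by (auto simp: wf_trs_def)
qed

lemma rules_basic: "(l, r) \<in> rules \<Longrightarrow> is_basic sig l"
  by (cases rule: rules_cases) (auto simp: is_basic_def dest: digit_opts)

lemma constructor_rules: "constructor_trs sig rules"
  using wf_rules rules_basic by (auto simp: constructor_trs_def)

section \<open>Orthogonality of the rules\<close>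

lemma left_linear_rules: "left_linear rules"
proof -
  have "distinct (vars_list l)" if "(l, r) \<in> rules" for l r
    using that
  proof (cases rule: rules_cases)
    case main
    have "concat (map (\<lambda>x. [x]) xs) = xs" for xs :: "nat list" by (induction xs) auto
    with main show ?thesis by (simp add: comp_def)
  next
    case (step q i j)
    then show ?thesis by (cases i; cases j) auto
  qed auto
  then show ?thesis by (auto simp: left_linear_def)
qed

text \<open>Rules with the same root symbol differ in a pattern or in the state, and an instance of
  a pattern determines the pattern. So unifiable left-hand sides come from the same rule.\<close>

lemma rules_no_root_overlap:
  assumes "(l\<^sub>1, r\<^sub>1) \<in> rules" "(l\<^sub>2, r\<^sub>2) \<in> rules" "subst \<sigma> l\<^sub>1 = subst \<tau> l\<^sub>2"
  shows "(l\<^sub>1, r\<^sub>1) = (l\<^sub>2, r\<^sub>2)"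
  using assms(1)
  by (cases rule: rules_cases; use assms(2,3) in \<open>cases rule: rules_cases\<close>)
    (auto dest!: subst_pat_inj)

lemma non_overlapping_rules: "non_overlapping rules"
proof -
  have False
    if r: "(l\<^sub>1, r\<^sub>1) \<in> rules" "(l\<^sub>2, r\<^sub>2) \<in> rules" and u: "u \<in> subterms l\<^sub>1" "\<nexists>x. u = Var x"
      and ne: "u \<noteq> l\<^sub>1 \<or> \<not> variants (l\<^sub>1, r\<^sub>1) (l\<^sub>2, r\<^sub>2)" and eq: "subst \<sigma> u = subst \<tau> l\<^sub>2"
    for l\<^sub>1 r\<^sub>1 l\<^sub>2 r\<^sub>2 u and \<sigma> \<tau> :: "nat \<Rightarrow> (symb, nat) trm"
  proof (cases "u = l\<^sub>1")
    case True
    then show False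
      using rules_no_root_overlap[OF r] eq ne variants_refl by metis
  next
    case False
    \<comment> \<open>Below the root a left-hand side is a value, so the non-variable
      \<open>u\<close> has a constructor at its root, whereas \<open>l\<^sub>2\<close> has a defined
      symbol there.\<close>
    then have "is_value sig u"
      using basic_proper_subterms[OF rules_basic[OF r(1)] u(1)] by blast
    then obtain c us where "u = Fun c us" "c \<in> constrs sig"
      using u(2) by (cases u) auto
    moreover obtain h ls where "l\<^sub>2 = Fun h ls" "h \<in> defined sig"
      using rules_basic[OF r(2)] by (auto simp: is_basic_def)
    ultimately show False using eq by auto
  qed
  then show ?thesis unfolding non_overlapping_def by blast
qed

section \<open>Orientation of the rules by the path order\<close>

abbreviation pop (infix ">\<^sub>p" 50) where
  "s >\<^sub>p t \<equiv> gt_pop sig symb_safe prec s t"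

lemma pop_rec:
  assumes "0 \<notin> fn_safe f"
  shows "Fun (fn f) (Fun g [t] # ts) >\<^sub>p Fun (fn f) (t # ts)"
  using assms by (intro gt_pop_rec gt_pop_arg) auto

text \<open>Wraps a recursive call into a smaller symbol with a safe position, as in
  \<open>Step(; Run(x; c))\<close>. With a single argument, the limit of one safe argument outside
  \<open>trms_below\<close> is automatic.\<close>

lemma pop_unary:
  assumes "prec_gt prec (fn f) g" "0 \<in> symb_safe g" "Fun (fn f) ss >\<^sub>p t"
  shows "Fun (fn f) ss >\<^sub>p Fun g [t]"
  using assms
  by (intro pop_precedence) (auto intro: order.trans[OF card_mono[of "{0}"]])

lemma pop_binary:
  assumes "prec_gt prec (fn f) g" "symb_safe g = {1}"
    and "gt_sq sig symb_safe prec (Fun (fn f) ss) s" "Fun (fn f) ss >\<^sub>p t"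
  shows "Fun (fn f) ss >\<^sub>p Fun g [s, t]"
proof (intro pop_precedence)
  show "card {j. j < length [s, t] \<and> j \<in> symb_safe g \<and> [s, t] ! j \<notin> trms_below prec (fn f)} \<le> 1"
    by (rule order.trans[OF card_mono[of "{1}"]]) (use assms(2) in auto)
qed (use assms in \<open>auto simp: less_Suc_eq\<close>)

lemma pop_nil: "Fun (fn f) ss >\<^sub>p nil"
  by (intro pop_precedence) auto

text \<open>\<open>Main\<close> and \<open>Step\<close> descend to smaller symbols only. In the
  other rules, the recursive call decreases by \<open>pop_equivalence\<close>, and a symbol around
  it is handled by \<open>pop_unary\<close> or \<open>pop_binary\<close>.\<close>

lemma rules_pop:
  assumes "(l, r) \<in> rules"
  shows "l >\<^sub>p r"
  using assms
proof (cases rule: rules_cases)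
  case main
  then show ?thesis
    using guarded_props[of "[0..<k]"] by (auto intro!: gt_pop_below simp: atLeast0LessThan)
next
  case (chk i)
  then show ?thesis by (cases i) (auto intro: gt_pop_arg intro!: pop_rec)
next
  case (app i)
  then show ?thesis by (cases i) (auto intro: gt_pop_arg intro!: pop_rec pop_unary)
next
  case (mult i)
  show ?thesis
  proof (cases i)
    case (Some a)
    have "l >\<^sub>p Fun (fn Mult) [Var 0, Var 1]"
      using mult Some by (auto intro!: pop_rec)
    moreover have "gt_sq sig symb_safe prec l (Var 1)"
      using mult by (auto intro!: gt_sq_arg)
    ultimately show ?thesis
      using mult Some by (auto intro!: pop_binary)
  qed (use mult in \<open>simp add: pop_nil\<close>)
next
  case (run i)
  then show ?thesis by (cases i) (auto intro: gt_pop_arg intro!: pop_rec pop_unary)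
next
  case (out i)
  then show ?thesis by (cases i) (auto intro!: pop_nil pop_rec pop_unary)
next
  case (out_state q)
  show ?thesis unfolding out_state by (intro gt_pop_rec gt_pop_arg) auto
next
  case (step q i j)
  then show ?thesis
    using step_rhs_value[of q i j]
    by (auto intro!: gt_pop_below_constrs safe_mapping_sig value_below)
qed

lemma predicative_rules: "predicative_recursive sig rules"
  unfolding predicative_recursive_def
  using constructor_rules safe_mapping_sig admissible rules_pop by blast


subsection \<open>Simulation of the machine\<close>

abbreviation reduces (infix "\<leadsto>" 50) where
  "s \<leadsto> t \<equiv> (irewrite rules)\<^sup>*\<^sup>* s t"

lemma root_step:
  assumes "(Fun h ls, r) \<in> rules" "\<forall>t\<in>set ls. is_value sig (subst \<sigma> t)"
  shows "Fun h (map (subst \<sigma>) ls) \<leadsto> subst \<sigma> r"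
  using irewrite_root_values[OF finite_sig constructor_rules assms(1)] assms(2) by blast

lemma word_value: "set as \<subseteq> A \<Longrightarrow> is_value sig t \<Longrightarrow> is_value sig (word as t)"
  by (induction as) auto

lemma reduces_unary: "s \<leadsto> t \<Longrightarrow> Fun h [s] \<leadsto> Fun h [t]"
  by (auto intro!: irewrite_args)

lemma reduces_binary: "s \<leadsto> s' \<Longrightarrow> t \<leadsto> t' \<Longrightarrow> Fun h [s, t] \<leadsto> Fun h [s', t']"
  by (auto intro!: irewrite_args)

lemma reduces_word: "s \<leadsto> t \<Longrightarrow> word as s \<leadsto> word as t"
  by (induction as) (auto intro: reduces_unary)

text \<open>Serves all rules that recurse on a word in the first argument: \<open>first as\<close>
  selects the rule, variable 0 becomes the tail, and variable 1 becomes the other argument.\<close>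

lemma root_step_word:
  assumes "(Fun h [pat (first as) 0, Var 1], r) \<in> rules" "set as \<subseteq> A" "is_value sig t"
  shows "Fun h [word as nil, t] \<leadsto> subst (\<lambda>x. if x = 0 then word (tl as) nil else t) r"
  using root_step[OF assms(1), of "\<lambda>x. if x = 0 then word (tl as) nil else t"] assms(2,3)
  by (auto simp: word_value)

lemma first_opts: "set as \<subseteq> A \<Longrightarrow> first as \<in> opts"
  by (cases as) auto

lemma app_rule: "i \<in> opts \<Longrightarrow> (Fun (fn App) [pat i 0, Var 1], app_rhs i) \<in> rules"
  and mult_rule: "i \<in> opts \<Longrightarrow> (Fun (fn Mult) [pat i 0, Var 1], mult_rhs i) \<in> rules"
  and run_rule: "i \<in> opts \<Longrightarrow> (Fun (fn Run) [pat i 0, Var 1], run_rhs i) \<in> rules"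
  and out_rule: "i \<in> opts \<Longrightarrow> (Fun (fn Out) [pat i 0], out_rhs i) \<in> rules"
  and chk_rule:
    "i \<in> {None, Some 1, Some 2} \<Longrightarrow> (Fun (fn Chk) [pat i 0, Var 1], chk_rhs i) \<in> rules"
  and out_state_rule:
    "q \<in> Q \<Longrightarrow> (Fun (fn Out) [Fun (state q) [Var 0, Var 1]], Fun (fn Out) [Var 1]) \<in> rules"
  unfolding rules_def by ((rule UnI2, erule imageI) | rule UnI1)+

lemma step_rule: "q \<in> Q \<Longrightarrow> i \<in> opts \<Longrightarrow> j \<in> opts \<Longrightarrow>
    (Fun (fn Step) [Fun (state q) [pat i 0, pat j 1]], step_rhs q i j) \<in> rules"
  unfolding rules_def by (rule UnI2, rule image_eqI[where x = "(q, i, j)"]) auto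

section \<open>Evaluation of the input and the clock\<close>

lemma reduces_app:
  assumes "set as \<subseteq> A" "is_value sig t"
  shows "Fun (fn App) [word as nil, t] \<leadsto> word as t"
  using assms(1)
proof (induction as)
  case Nil
  show ?case
    using root_step_word[OF app_rule, of "[]" t] assms(2) by simp
next
  case (Cons a as)
  have "Fun (fn App) [word (a # as) nil, t] \<leadsto> Fun (tape a) [Fun (fn App) [word as nil, t]]"
    using root_step_word[OF app_rule, of "a # as" t] Cons.prems assms(2) by simp
  also have "\<dots> \<leadsto> Fun (tape a) [word as t]"
    using Cons by (intro reduces_unary) auto
  finally show ?case by simp
qed

lemma reduces_mult:
  assumes "set as \<subseteq> A" "set bs \<subseteq> A"
  shows "Fun (fn Mult) [word as nil, word bs nil] \<leadsto> word (concat (replicate (length as) bs)) nil"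
  using assms(1)
proof (induction as)
  case Nil
  show ?case
    using root_step_word[OF mult_rule, of "[]" "word bs nil"] assms(2) by (simp add: word_value)
next
  case (Cons a as)
  let ?cs = "concat (replicate (length as) bs)"
  have "Fun (fn Mult) [word (a # as) nil, word bs nil] \<leadsto>
      Fun (fn App) [word bs nil, Fun (fn Mult) [word as nil, word bs nil]]"
    using root_step_word[OF mult_rule, of "a # as" "word bs nil"] Cons.prems assms(2)
    by (simp add: word_value)
  also have "\<dots> \<leadsto> Fun (fn App) [word bs nil, word ?cs nil]"
    using Cons by (intro reduces_binary) auto
  also have "\<dots> \<leadsto> word bs (word ?cs nil)"
    using assms(2) by (intro reduces_app word_value) (auto split: if_splits)
  finally show ?case by (simp add: word_append)
qed

lemma digits_letters: "set (digits n) \<subseteq> A"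
  using set_digits[of n] letters by auto

lemma numeral_value: "is_value sig (numeral_trm n :: (symb, nat) trm)"
  by (simp add: numeral_trm_word word_value digits_letters)

lemma input_letters: "set (input_word xs) \<subseteq> A"
  by (induction xs) (auto simp: input_word_def dest: digits_letters[THEN subsetD])

lemma reduces_input:
  assumes "\<And>i. i \<in> set is \<Longrightarrow> \<sigma> i = numeral_trm (v i)"
  shows "subst \<sigma> (input_term is) \<leadsto> word (input_word (map v is)) nil"
  using assms
proof (induction "is")
  case (Cons i "is")
  let ?w = "word (input_word (map v is)) nil"
  have "subst \<sigma> (input_term (i # is)) \<leadsto> Fun (fn App) [word (digits (v i)) nil, Fun (tape 3) [?w]]"
    using Cons by (auto simp: input_term_def numeral_trm_word intro!: reduces_binary reduces_unary)
  also have "\<dots> \<leadsto> word (digits (v i)) (Fun (tape 3) [?w])"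
    using word_value[OF input_letters, of nil "map v is"] digits_letters
    by (intro reduces_app) auto
  finally show ?case by (simp add: input_word_def word_append)
qed (simp add: input_term_def input_word_def)

text \<open>The recursion of \<open>horner_sum\<close> is that of \<open>clock\<close>: the new
  length is \<open>c\<close> plus the length of \<open>ws\<close> times the previous length.\<close>

lemma reduces_clock:
  assumes "subst \<sigma> (input_term [0..<k]) \<leadsto> word ws nil" "set ws \<subseteq> A"
  shows "\<exists>as. set as \<subseteq> A \<and> length as = horner_sum id (length ws) cs \<and>
    subst \<sigma> (clock cs) \<leadsto> word as nil"
proof (induction cs)
  case Nil
  show ?case by (simp add: clock_def)
next
  case (Cons c cs)
  then obtain as where as: "set as \<subseteq> A" "length as = horner_sum id (length ws) cs"
    "subst \<sigma> (clock cs) \<leadsto> word as nil" by blast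
  let ?bs = "replicate c 1 @ concat (replicate (length ws) as)"
  have "subst \<sigma> (clock (c # cs)) \<leadsto> word (replicate c 1) (Fun (fn Mult) [word ws nil, word as nil])"
    using assms as by (auto simp: clock_def intro!: reduces_word reduces_binary)
  also have "\<dots> \<leadsto> word ?bs nil"
    unfolding word_append using assms as by (intro reduces_word reduces_mult)
  finally have "subst \<sigma> (clock (c # cs)) \<leadsto> word ?bs nil" .
  moreover have "set ?bs \<subseteq> A" using as letters by (auto split: if_splits)
  moreover have "length ?bs = horner_sum id (length ws) (c # cs)"
    using as by (simp add: length_concat sum_list_replicate)
  ultimately show ?case by blast
qed

section \<open>Configurations and runs\<close>

fun wf_config :: "config \<Rightarrow> bool" where
  "wf_config (q, ls, rs) \<longleftrightarrow> q \<in> Q \<and> set ls \<subseteq> A \<and> set rs \<subseteq> A"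

abbreviation next_config :: "config \<Rightarrow> config" where
  "next_config c \<equiv> (case tm_step M c of None \<Rightarrow> c | Some c' \<Rightarrow> c')"

text \<open>The additional step is applied last, just as \<open>Run\<close> places
  \<open>Step\<close> outside its recursive call.\<close>

lemma tm_run_0: "tm_run M 0 c = c"
  and tm_run_Suc: "tm_run M (Suc n) c = next_config (tm_run M n c)"
  by (simp_all add: tm_run_def[abs_def] split: option.split)

lemma cell_letter: "set as \<subseteq> A \<Longrightarrow> cell as < n_symbols M"
  using letters by (cases as) auto

lemma tl_letters: "set as \<subseteq> A \<Longrightarrow> set (tl as) \<subseteq> A"
  by (cases as) auto

lemma wf_next_config:
  assumes "wf_config c"
  shows "wf_config (next_config c)"
proof -
  obtain q ls rs where c: "c = (q, ls, rs)" by (cases c)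
  show ?thesis
  proof (cases "delta M q (cell rs)")
    case (Some a)
    obtain q' b d where a: "a = (q', b, d)" by (cases a)
    have "q' < n_states M" "b < n_symbols M"
      using delta_wf[of q "cell rs" q' b d] Some assms c a cell_letter[of rs] by auto
    then show ?thesis
      using Some assms c a cell_letter[of ls] tl_letters[of ls] tl_letters[of rs]
      by (cases d) auto
  qed (use assms c in auto)
qed

lemma wf_tm_run: "wf_config c \<Longrightarrow> wf_config (tm_run M n c)"
proof (induction n)
  case (Suc n)
  then show ?case using wf_next_config[of "tm_run M n c"] by (simp add: tm_run_Suc)
qed (simp add: tm_run_0)

lemma cfg_value: "wf_config c \<Longrightarrow> is_value sig (cfg c)"
  by (cases c) (auto intro: word_value)

lemma reduces_step:
  assumes "wf_config c"
  shows "Fun (fn Step) [cfg c] \<leadsto> cfg (next_config c)"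
proof -
  obtain q ls rs where c: "c = (q, ls, rs)" by (cases c)
  \<comment> \<open>Variables 0 and 1 stand for the tails of the two words. As \<open>tl []\<close>
    is \<open>[]\<close>, the same substitution fits empty words.\<close>
  let ?\<sigma> = "\<lambda>x::nat. if x = 0 then word (tl ls) nil else word (tl rs) nil"
  have "(Fun (fn Step) [Fun (state q) [pat (first ls) 0, pat (first rs) 1]],
      step_rhs q (first ls) (first rs)) \<in> rules"
    using assms c by (intro step_rule first_opts) auto
  from root_step[OF this, of ?\<sigma>]
  have "Fun (fn Step) [cfg c] \<leadsto> subst ?\<sigma> (step_rhs q (first ls) (first rs))"
    using assms c by (auto simp: word_value)
  also have "subst ?\<sigma> (step_rhs q (first ls) (first rs)) = cfg (next_config c)"
    using c by (auto simp: step_rhs_def split: option.splits direction.splits)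
  finally show ?thesis .
qed

lemma reduces_run:
  assumes "set as \<subseteq> A" "wf_config c"
  shows "Fun (fn Run) [word as nil, cfg c] \<leadsto> cfg (tm_run M (length as) c)"
  using assms(1)
proof (induction as)
  case Nil
  show ?case
    using root_step_word[OF run_rule, of "[]" "cfg c"] assms(2) by (simp add: cfg_value tm_run_0)
next
  case (Cons a as)
  have "Fun (fn Run) [word (a # as) nil, cfg c] \<leadsto> Fun (fn Step) [Fun (fn Run) [word as nil, cfg c]]"
    using root_step_word[OF run_rule, of "a # as" "cfg c"] Cons.prems assms(2)
    by (simp add: cfg_value)
  also have "\<dots> \<leadsto> Fun (fn Step) [cfg (tm_run M (length as) c)]"
    using Cons by (intro reduces_unary) auto
  also have "\<dots> \<leadsto> cfg (tm_run M (length (a # as)) c)"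
    using reduces_step[OF wf_tm_run[OF assms(2)]] by (simp add: tm_run_Suc)
  finally show ?case .
qed

lemma reduces_out_word:
  assumes "set as \<subseteq> A"
  shows "Fun (fn Out) [word as nil] \<leadsto> word (takeWhile (\<lambda>a. a \<in> {1, 2}) as) nil"
  using assms
proof (induction as)
  case Nil
  show ?case
    using root_step[OF out_rule, of None] by simp
next
  case (Cons a as)
  have step: "Fun (fn Out) [word (a # as) nil] \<leadsto> subst (\<lambda>_. word as nil) (out_rhs (Some a))"
    using root_step[OF out_rule, of "Some a" "\<lambda>_. word as nil"] Cons.prems by (simp add: word_value)
  show ?case
  proof (cases "a \<in> {1, 2}")
    case True
    then have "Fun (fn Out) [word (a # as) nil] \<leadsto> Fun (tape a) [Fun (fn Out) [word as nil]]"
      using step by auto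
    also have "\<dots> \<leadsto> Fun (tape a) [word (takeWhile (\<lambda>a. a \<in> {1, 2}) as) nil]"
      using Cons by (intro reduces_unary) auto
    finally show ?thesis using True by auto
  qed (use step in auto)
qed

lemma reduces_out:
  assumes "wf_config c"
  shows "Fun (fn Out) [cfg c] \<leadsto> word (output_word c) nil"
proof -
  obtain q ls rs where c: "c = (q, ls, rs)" by (cases c)
  have "Fun (fn Out) [cfg c] \<leadsto> Fun (fn Out) [word rs nil]"
    using root_step[OF out_state_rule, of q "\<lambda>x. if x = 0 then word ls nil else word rs nil"]
      assms c by (auto simp: word_value)
  also have "\<dots> \<leadsto> word (output_word c) nil"
    using reduces_out_word[of rs] assms c by simp
  finally show ?thesis .
qed

lemma reduces_chk:
  assumes "is_value sig t"
  shows "Fun (fn Chk) [numeral_trm n, t] \<leadsto> t"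
proof -
  \<comment> \<open>Passing from the numeral to an arbitrary word of digits lets the induction drop
    the first digit.\<close>
  have "Fun (fn Chk) [word as nil, t] \<leadsto> t" if "set as \<subseteq> {1, 2}" for as
    using that
  proof (induction as)
    case Nil
    show ?case using root_step_word[OF chk_rule, of "[]" t] assms by simp
  next
    case (Cons a as)
    have "set (a # as) \<subseteq> A" using Cons.prems letters by auto
    then have "Fun (fn Chk) [word (a # as) nil, t] \<leadsto> Fun (fn Chk) [word as nil, t]"
      using root_step_word[OF chk_rule, of "a # as" t] Cons.prems assms by auto
    then show ?case using Cons by auto
  qed
  then show ?thesis using set_digits by (simp add: numeral_trm_word)
qed

text \<open>The clock runs for exactly the polynomial bound, while the machine may halt
  earlier.\<close>

lemma tm_run_halted:
  assumes "tm_step M (tm_run M n c) = None" "n \<le> m"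
  shows "tm_run M m c = tm_run M n c"
  using assms(2)
  by (induction rule: dec_induct) (use assms(1) in \<open>simp_all add: tm_run_Suc\<close>)

lemma reduces_main:
  assumes len: "length xs = k"
    and halt: "n \<le> poly p (length (input_word xs))"
      "tm_step M (tm_run M n (0, [], input_word xs)) = None"
      "output_word (tm_run M n (0, [], input_word xs)) = digits y"
  shows "Fun (fn Main) (map numeral_trm xs) \<leadsto> numeral_trm y"
proof -
  define \<sigma> where "\<sigma> = (\<lambda>i. numeral_trm (xs ! i) :: (symb, nat) trm)"
  let ?c = "(0, [], input_word xs)"
  have "map (nth xs) [0..<k] = xs" using len map_nth by blast
  then have inp: "subst \<sigma> (input_term [0..<k]) \<leadsto> word (input_word xs) nil"
    using reduces_input[of "[0..<k]" \<sigma> "nth xs"] by (simp add: \<sigma>_def)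
  obtain as where as: "set as \<subseteq> A" "length as = poly p (length (input_word xs))"
    "subst \<sigma> (clock (coeffs p)) \<leadsto> word as nil"
    \<comment> \<open>\<open>poly_def\<close> identifies the Horner sum over \<open>coeffs p\<close>
      with the value of \<open>p\<close> at the input length.\<close>
    using reduces_clock[OF inp input_letters] unfolding poly_def by blast
  have c: "wf_config ?c" using input_letters by auto
  have "subst \<sigma> body \<leadsto> Fun (fn Out) [Fun (fn Run) [word as nil, cfg ?c]]"
    using as(3) inp by (auto simp: body_def intro!: reduces_unary reduces_binary)
  also have "\<dots> \<leadsto> Fun (fn Out) [cfg (tm_run M (length as) ?c)]"
    by (intro reduces_unary reduces_run as(1) c)
  also have "\<dots> \<leadsto> word (output_word (tm_run M (length as) ?c)) nil"
    by (intro reduces_out wf_tm_run c)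
  finally have body: "subst \<sigma> body \<leadsto> numeral_trm y"
    using tm_run_halted[OF halt(2), of "length as"] as(2) halt by (simp add: numeral_trm_word)
  \<comment> \<open>Every index is mapped to a numeral by \<open>\<sigma>\<close>, so each guard
    lets the result through.\<close>
  have "subst \<sigma> (guarded is) \<leadsto> numeral_trm y" for "is"
  proof (induction "is")
    case (Cons i "is")
    have "subst \<sigma> (guarded (i # is)) \<leadsto> Fun (fn Chk) [numeral_trm (xs ! i), numeral_trm y]"
      using Cons by (auto simp: guarded_def \<sigma>_def intro!: reduces_binary)
    then show ?case using reduces_chk numeral_value by (meson rtranclp_trans)
  qed (use body in \<open>simp add: guarded_def\<close>)
  moreover have "Fun (fn Main) (map (subst \<sigma>) (map Var [0..<k])) \<leadsto> subst \<sigma> (guarded [0..<k])"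
    by (rule root_step) (auto simp: rules_def \<sigma>_def numeral_value)
  moreover have "map (subst \<sigma>) (map Var [0..<k]) = map numeral_trm xs"
    using len by (auto simp: \<sigma>_def intro: nth_equalityI)
  ultimately show ?thesis by (metis rtranclp_trans)
qed


subsection \<open>Calls on other values\<close>

text \<open>These terms may still be reducible. They form an invariant: the set is closed under
  rewriting and contains no value, as \<open>Main\<close> or \<open>Chk\<close> remains at the
  root.\<close>

inductive stuck :: "(symb, nat) trm \<Rightarrow> bool" where
  main: "\<lbrakk>\<forall>v\<in>set vs. is_value sig v; \<exists>v\<in>set vs. v \<notin> range numeral_trm\<rbrakk> \<Longrightarrow> stuck (Fun (fn Main) vs)"
| chk: "\<lbrakk>is_value sig v; v \<notin> range numeral_trm \<or> stuck t\<rbrakk> \<Longrightarrow> stuck (Fun (fn Chk) [v, t])"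

text \<open>Prefixing the digit \<open>a\<close> turns \<open>n\<close> into
  \<open>2 * n + a\<close>. In contrapositive form: when \<open>Chk\<close> strips a digit off a
  value that is no numeral, what remains is no numeral either.\<close>

lemma numeral_trm_digit:
  fixes v :: "(symb, nat) trm"
  assumes "v \<in> range numeral_trm" "a = 1 \<or> a = 2"
  shows "Fun (tape a) [v] \<in> range numeral_trm"
proof -
  obtain n where "v = numeral_trm n" using assms(1) by blast
  then have "Fun (tape a) [v] = numeral_trm (2 * n + a)"
    using assms(2) digits_double_plus_1[of n] digits_double_plus_2[of n]
    by (auto simp: numeral_trm_word)
  then show ?thesis by blast
qed

text \<open>The guard of an offending argument is stuck by itself, and the guards around it are
  stuck because their second argument is.\<close>

lemma stuck_guarded:
  assumes "\<forall>i\<in>set is. is_value sig (\<sigma> i)" "\<exists>i\<in>set is. \<sigma> i \<notin> range numeral_trm"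
  shows "stuck (subst \<sigma> (guarded is))"
  using assms by (induction "is") (auto simp: guarded_def intro!: stuck.chk)

lemma value_irreducible: "is_value sig v \<Longrightarrow> \<not> rewrite rules v t"
  using value_normal_form[OF finite_sig constructor_rules] by (auto simp: normal_form_def)

lemma rewrite_stuck:
  assumes "stuck s" "rewrite rules s t"
  shows "stuck t"
  using assms
proof (induction arbitrary: t rule: stuck.induct)
  case (main vs)
  from main(3) show ?case
  proof (cases rule: rewrite.cases)
    case (1 l r \<sigma>)
    from 1(3) show ?thesis
    proof (cases rule: rules_cases)
      case main': main
      then have "vs = map \<sigma> [0..<k]" using 1 by (simp add: comp_def)
      then show ?thesis
        using main' 1 main(1,2) by (auto intro!: stuck_guarded)
    qed (use 1 in auto)
  next
    case 2
    then show ?thesis using main(1) value_irreducible by auto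
  qed
next
  case (chk v t')
  from chk(3) show ?case
  proof (cases rule: rewrite.cases)
    case (1 l r \<sigma>)
    from 1(3) show ?thesis
    proof (cases rule: rules_cases)
      case chk': (chk i)
      show ?thesis
      proof (cases i)
        case None
        \<comment> \<open>The rule that removes \<open>Chk\<close> applies only to the numeral 0, so
          the released term must have been the stuck one.\<close>
        have "nil = (numeral_trm 0 :: (symb, nat) trm)" by (simp add: numeral_trm_def)
        then have "nil \<in> range (numeral_trm :: nat \<Rightarrow> (symb, nat) trm)" by (metis rangeI)
        then show ?thesis using None chk' 1 chk(2) by auto
      next
        case (Some a)
        then show ?thesis
          using chk' 1 chk(1,2) numeral_trm_digit[of "\<sigma> 0" a] by (auto intro!: stuck.chk)
      qed
    qed (use 1 in auto)
  next
    case (2 s u us vs)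
    then consider "us = []" "s = v" | "us = [v]" "s = t'" "vs = []"
      by (auto simp: Cons_eq_append_conv append_eq_Cons_conv)
    then show ?thesis
    proof cases
      case 1
      then show ?thesis using 2 chk(1) value_irreducible by auto
    next
      case 2
      \<comment> \<open>The induction hypothesis is part of the second disjunct of
        \<open>chk(2)\<close>; in the first disjunct the guard alone keeps the term stuck.\<close>
      then show ?thesis using \<open>t = _\<close> \<open>rewrite rules s u\<close> chk(1,2) by (auto intro!: stuck.chk)
    qed
  qed
qed

lemma stuck_reduces: "s \<leadsto> t \<Longrightarrow> stuck s \<Longrightarrow> stuck t"
  by (induction rule: rtranclp_induct) (auto intro: rewrite_stuck irewrite_imp_rewrite)

lemma stuck_not_value: "stuck t \<Longrightarrow> \<not> is_value sig t"
  by (cases rule: stuck.cases) auto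

text \<open>The simulation gives one inclusion. Conversely, a call that reaches a value was not
  stuck, so its arguments are numerals, and uniqueness of normal forms identifies the value with the
  simulated result.\<close>

lemma computes_rules:
  assumes f: "\<And>xs. length xs = k \<Longrightarrow>
    \<exists>n \<le> poly p (length (input_word xs)).
      let c = tm_run M n (0, [], input_word xs)
      in tm_step M c = None \<and> output_word c = digits (f xs)"
  shows "computes sig rules k f"
proof -
  have nf: "normal_form rules v" if "is_value sig v" for v
    using value_normal_form[OF finite_sig constructor_rules that] .
  have eval: "Fun (fn Main) (map numeral_trm xs) \<leadsto> numeral_trm (f xs)" if "length xs = k" for xs
    using f[OF that] reduces_main[OF that] by (auto simp: Let_def)
  have "\<exists>xs. vs = map numeral_trm xs \<and> w = numeral_trm (f xs) \<and> length xs = k"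
    if vs: "length vs = k" "\<forall>v\<in>set vs. is_value sig v" and w: "is_value sig w"
      and red: "Fun (fn Main) vs \<leadsto> w" for vs w
  proof -
    have "\<not> stuck (Fun (fn Main) vs)"
      using stuck_reduces[OF red] stuck_not_value w by blast
    then have "set vs \<subseteq> range numeral_trm"
      using vs(2) by (auto intro: stuck.main)
    then obtain xs where xs: "vs = map numeral_trm xs"
      using ex_map_conv[of vs numeral_trm] by blast
    have "w = numeral_trm (f xs)"
      using irewrite_normal_form_unique[OF wf_rules non_overlapping_rules red] eval xs vs(1) nf
        numeral_value w by simp
    then show ?thesis using xs vs(1) by auto
  qed
  then have "defined_relation sig rules (fn Main) =
      {(map numeral_trm xs, numeral_trm (f xs)) |xs. length xs = k}"
    using eval nf numeral_value by (auto simp: defined_relation_def)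
  then have "\<exists>g\<in>defined sig. arity sig g = k \<and> defined_relation sig rules g =
      {(map numeral_trm xs, numeral_trm (f xs)) |xs. length xs = k}"
    by (intro bexI[of _ "fn Main"]) auto
  moreover have S: "S1 = tape 1" "S2 = tape 2" by (simp_all add: tape_def)
  have "{Eps, S1, S2} \<subseteq> constrs sig \<and> arity sig Eps = 0 \<and> arity sig S1 = 1 \<and> arity sig S2 = 1"
    unfolding S using letters by auto
  ultimately show ?thesis
    unfolding computes_def by blast
qed

end

theorem theorem6p5:
  fixes f :: "nat list \<Rightarrow> nat" and k :: nat
  assumes "f \<in> FP k"
  shows "\<exists>(F :: symb signature) (R :: (symb, nat) trs).
           finite_signature F \<and> finite R \<and> orthogonal R \<and> predicative_recursive F R \<and>
           computes F R k f"
proof -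
  obtain M p where M: "wf_tm M" and f: "\<And>xs. length xs = k \<Longrightarrow>
    \<exists>n \<le> poly p (length (input_word xs)).
      let c = tm_run M n (0, [], input_word xs)
      in tm_step M c = None \<and> output_word c = digits (f xs)"
    using assms by (auto simp: FP_def)
  interpret tm_trs M k p
    by unfold_locales (rule M)
  show ?thesis
    using finite_sig finite_rules left_linear_rules non_overlapping_rules predicative_rules
      computes_rules[OF f] unfolding orthogonal_def by blast
qed

end
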